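(* For each even integer $h\geq 2$, there is a poset of height $h$ with dimension at least $2^{h/2}$ whose cover graph excludes $K_5$ as a minor.
   Context: All posets are finite. The height of a poset is the maximum size of a chain in it. The dimension of a poset $P$ is the least integer $d$ such that $P$ is the intersection of $d$ linear orders. A cover relation of $P$ is a relation $a\leq b$ in $P$ with $a\neq b$ such that there is no element $c$ distinct from $a,b$ with $a\leq c\leq b$ in $P$. The cover graph of $P$ is the undirected graph whose vertices are the elements of $P$ and in which two elements are adjacent if they are in a cover relation in $P$. *)

theory Defs
  imports "Graph_Theory.Kuratowski"
begin

definition finite_poset :: "'a set \<Rightarrow> 'a rel \<Rightarrow> bool" where
  "finite_poset A r \<longleftrightarrow> finite A \<and> partial_order_on A r"

definition height :: "'a set \<Rightarrow> 'a rel \<Rightarrow> nat" where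
  "height A r = Max (card ` {C \<in> Chains r. C \<subseteq> A})"

(* The intersection of the empty family would be the universal relation on the whole type,
   not on A, hence L must be nonempty. *)
definition realizer :: "'a set \<Rightarrow> 'a rel \<Rightarrow> 'a rel set \<Rightarrow> bool" where
  "realizer A r L \<longleftrightarrow>
     finite L \<and> L \<noteq> {} \<and> (\<forall>l\<in>L. linear_order_on A l) \<and> r = \<Inter>L"

definition poset_dim :: "'a set \<Rightarrow> 'a rel \<Rightarrow> nat" where
  "poset_dim A r = (LEAST d. \<exists>L. realizer A r L \<and> card L = d)"

definition covers :: "'a set \<Rightarrow> 'a rel \<Rightarrow> 'a \<Rightarrow> 'a \<Rightarrow> bool" where
  "covers A r a b \<longleftrightarrow>
     a \<in> A \<and> b \<in> A \<and> (a, b) \<in> r \<and> a \<noteq> b \<and>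
     \<not> (\<exists>c\<in>A. c \<noteq> a \<and> c \<noteq> b \<and> (a, c) \<in> r \<and> (c, b) \<in> r)"

(* As in the imported graph library, an undirected graph is a symmetric loop-free digraph. *)
definition cover_graph :: "'a set \<Rightarrow> 'a rel \<Rightarrow> 'a pair_pre_digraph" where
  "cover_graph A r = \<lparr>pverts = A, parcs = {(a, b). covers A r a b \<or> covers A r b a}\<rparr>"

lemma pair_graph_cover_graph:
  assumes "finite A"
  shows "pair_graph (cover_graph A r)"
proof -
  have "parcs (cover_graph A r) \<subseteq> A \<times> A"
    by (auto simp: cover_graph_def covers_def)
  then have "finite (parcs (cover_graph A r))"
    using assms by (meson finite_SigmaI finite_subset)
  then show ?thesis
    using assms
    by unfold_locales
      (auto simp: cover_graph_def covers_def symmetric_def intro!: symI)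
qed

(* H is a minor of G: there are pairwise disjoint connected branch sets B u in G, one for
   each vertex u of H, with an edge of G between B u and B v for every edge uv of H.
   Branch sets are nonempty, because connected digraphs are nonempty in the library. *)
definition minor_of :: "'a pair_pre_digraph \<Rightarrow> 'b pair_pre_digraph \<Rightarrow> bool" where
  "minor_of H G \<longleftrightarrow>
     (\<exists>B :: 'a \<Rightarrow> 'b set.
        (\<forall>u\<in>pverts H. B u \<subseteq> pverts G \<and>
           Digraph_Component.connected (induce_subgraph (with_proj G) (B u))) \<and>
        (\<forall>u\<in>pverts H. \<forall>v\<in>pverts H. u \<noteq> v \<longrightarrow> B u \<inter> B v = {}) \<and>
        (\<forall>(u, v)\<in>parcs H. \<exists>x\<in>B u. \<exists>y\<in>B v. (x, y) \<in> parcs G))"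

end

theory Submission
  imports Defs "HOL-Library.Sublist" "HOL-Library.Countable"
begin

text \<open>
  For \<open>h = 2 k\<close>, take two elements \<open>dn s\<close> and \<open>up s\<close> for every nonempty binary word \<open>s\<close> of length at
  most \<open>k\<close>. Lengthening \<open>s\<close> moves \<open>dn s\<close> down and \<open>up s\<close> up, and \<open>dn s\<close> lies below \<open>up t\<close> exactly when
  neither of \<open>s\<close>, \<open>t\<close> is a prefix of the other. The words of length \<open>k\<close> then give a standard example
  of size \<open>2 ^ k\<close>.

  The cover graph is a tree-like union of copies of \<open>K\<^bsub>3,3\<^esub>\<close>, one per word \<open>u\<close>, on the six elements
  with word \<open>u\<close>, \<open>u0\<close> or \<open>u1\<close>, glued along the (virtual) edges between \<open>dn v\<close> and \<open>up v\<close>. Given five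
  branch sets, choose \<open>u\<close> as long as possible such that some branch set uses only proper extensions
  of \<open>u\<close>. Then adjacency of two branch sets is witnessed inside the copy at \<open>u\<close>, so at most one of
  the five avoids the colour class \<open>{dn u, up u0, up u1}\<close>. The other four cannot all be disjoint.
\<close>

section \<open>Dimension\<close>

text \<open>The added pairs are those forced by putting \<open>y\<close> below \<open>x\<close>.
  Chaining two of them would give \<open>(x, y) \<in> r\<close>, so one round is already transitive;
  antisymmetry holds for the same reason.\<close>

lemma partial_order_on_add_pair:
  assumes r: "partial_order_on A r" and xy: "x \<in> A" "y \<in> A" "(x, y) \<notin> r"
  shows "partial_order_on A (r \<union> {(p, q). (p, y) \<in> r \<and> (x, q) \<in> r})"
proof -
  note D = partial_order_onD[OF r]
  have "trans (r \<union> {(p, q). (p, y) \<in> r \<and> (x, q) \<in> r})"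
    using D(2) xy(3) unfolding trans_def by blast
  moreover have "antisym (r \<union> {(p, q). (p, y) \<in> r \<and> (x, q) \<in> r})"
    using D(2,3) xy(3) unfolding trans_def antisym_def by blast
  moreover have "refl_on A (r \<union> {(p, q). (p, y) \<in> r \<and> (x, q) \<in> r})"
    using D(1) by (auto simp: refl_on_def)
  ultimately show ?thesis
    using D(4) by (auto simp: partial_order_on_def preorder_on_def)
qed

text \<open>A maximal partial order extending \<open>r\<close> is total, since an incomparable pair
  could still be added.\<close>

lemma finite_linear_extension:
  assumes A: "finite A" and r: "partial_order_on A r"
  obtains l where "linear_order_on A l" "r \<subseteq> l"
proof -
  let ?S = "{l. partial_order_on A l \<and> r \<subseteq> l}"
  have "?S \<subseteq> Pow (A \<times> A)" using partial_order_onD(4) by blast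
  then have "finite ?S" using A by (meson finite_Pow_iff finite_SigmaI finite_subset)
  moreover have "r \<in> ?S" using r by simp
  ultimately have "\<exists>l\<in>?S. \<forall>m\<in>?S. l \<subseteq> m \<longrightarrow> l = m"
    by (intro finite_has_maximal) auto
  then obtain l where l: "l \<in> ?S" and max: "\<And>m. m \<in> ?S \<Longrightarrow> l \<subseteq> m \<Longrightarrow> l = m"
    by (elim bexE) simp
  have "total_on A l"
  proof (rule total_onI, rule ccontr)
    fix x y assume xy: "x \<in> A" "y \<in> A" "\<not> ((x, y) \<in> l \<or> (y, x) \<in> l)"
    let ?m = "l \<union> {(p, q). (p, y) \<in> l \<and> (x, q) \<in> l}"
    have "partial_order_on A ?m"
      using l xy by (intro partial_order_on_add_pair) auto
    then have "l = ?m" using l by (intro max) auto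
    moreover have "(y, x) \<in> ?m"
      using l xy by (auto simp: order_on_defs refl_on_def)
    ultimately show False using xy by blast
  qed
  then show thesis using that l by (auto simp: linear_order_on_def)
qed

text \<open>Ensures that the \<open>LEAST\<close> in \<open>poset_dim\<close> is attained. All
  linear extensions together work: for distinct \<open>x\<close>, \<open>y\<close> in
  \<open>A\<close> with \<open>(x, y) \<notin> r\<close>, some extension puts \<open>y\<close> below
  \<open>x\<close>.\<close>

lemma realizer_exists:
  assumes A: "finite A" and r: "partial_order_on A r"
  shows "\<exists>L. realizer A r L"
proof -
  let ?L = "{l. linear_order_on A l \<and> r \<subseteq> l}"
  have sub: "?L \<subseteq> Pow (A \<times> A)"
    using partial_order_onD(4) by (auto simp: linear_order_on_def)
  then have fin: "finite ?L" using A by (meson finite_Pow_iff finite_SigmaI finite_subset)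
  have ne: "?L \<noteq> {}" using finite_linear_extension[OF A r] by blast
  have "(x, y) \<in> r" if in_all: "\<And>l. l \<in> ?L \<Longrightarrow> (x, y) \<in> l" for x y
  proof (rule ccontr)
    assume n: "(x, y) \<notin> r"
    have xy: "x \<in> A" "y \<in> A" using ne sub in_all by blast+
    obtain l where l: "linear_order_on A l"
      "r \<union> {(p, q). (p, y) \<in> r \<and> (x, q) \<in> r} \<subseteq> l"
      using finite_linear_extension[OF A partial_order_on_add_pair[OF r xy n]] .
    have "(y, x) \<in> l" using l(2) xy r by (auto simp: order_on_defs refl_on_def)
    moreover have "(x, y) \<in> l" using l by (intro in_all) auto
    ultimately have "x = y" using l(1) by (auto simp: order_on_defs antisym_def)
    then show False using n xy r by (auto simp: order_on_defs refl_on_def)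
  qed
  then have "r = \<Inter>?L" by auto
  then show ?thesis unfolding realizer_def using fin ne by (intro exI[of _ ?L]) blast
qed

text \<open>A linear order containing \<open>r\<close> can omit only one pair
  \<open>(x i, y i)\<close>: if it also omitted \<open>(x j, y j)\<close>, the path
  \<open>x i\<close>, \<open>y j\<close>, \<open>x j\<close>, \<open>y i\<close> would ascend in it.
  So distinct indices need distinct members of a realizer.\<close>

lemma card_standard_example_le_poset_dim:
  assumes P: "finite_poset A r"
    and xy: "\<And>i. i \<in> I \<Longrightarrow> x i \<in> A" "\<And>i. i \<in> I \<Longrightarrow> y i \<in> A"
    and inc: "\<And>i. i \<in> I \<Longrightarrow> (x i, y i) \<notin> r"
    and comp: "\<And>i j. i \<in> I \<Longrightarrow> j \<in> I \<Longrightarrow> i \<noteq> j \<Longrightarrow> (x i, y j) \<in> r"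
  shows "card I \<le> poset_dim A r"
proof -
  obtain L where "realizer A r L" using realizer_exists P unfolding finite_poset_def by blast
  then have "\<exists>L'. realizer A r L' \<and> card L' = card L" by blast
  then have "\<exists>L'. realizer A r L' \<and> card L' = poset_dim A r"
    unfolding poset_dim_def by (rule LeastI)
  then obtain L where L: "realizer A r L" and card: "card L = poset_dim A r" by blast
  have "\<forall>i\<in>I. \<exists>l\<in>L. (x i, y i) \<notin> l" using inc L by (auto simp: realizer_def)
  then obtain f where f: "\<And>i. i \<in> I \<Longrightarrow> f i \<in> L \<and> (x i, y i) \<notin> f i" by metis
  have "inj_on f I"
  proof (rule inj_onI, rule ccontr)
    fix i j assume ij: "i \<in> I" "j \<in> I" "f i = f j" "i \<noteq> j"
    have lin: "linear_order_on A (f i)" using f ij L by (auto simp: realizer_def)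
    have "(x i, y j) \<in> f i" "(x j, y i) \<in> f i"
      using comp[of i j] comp[of j i] ij f L by (auto simp: realizer_def)
    moreover have "(y j, x j) \<in> f i"
    proof (cases "x j = y j")
      case True
      then show ?thesis using lin xy ij by (auto simp: order_on_defs refl_on_def)
    next
      case False
      moreover have "(x j, y j) \<notin> f i" using f ij by metis
      ultimately show ?thesis using lin xy ij unfolding order_on_defs total_on_def by blast
    qed
    ultimately have "(x i, y i) \<in> f i"
      using lin unfolding order_on_defs trans_def by blast
    then show False using f ij by blast
  qed
  moreover have "f ` I \<subseteq> L" "finite L" using f L by (auto simp: realizer_def)
  ultimately show ?thesis using card card_inj_on_le by metis
qed

section \<open>Height\<close>

text \<open>A function separating distinct comparable elements is injective on every chain, so its
  number of values bounds the chains; \<open>C\<close> attains the bound.\<close>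

lemma height_eqI:
  fixes \<rho> :: "'a \<Rightarrow> nat"
  assumes fin: "finite A"
    and rank: "\<And>x. x \<in> A \<Longrightarrow> \<rho> x < n"
      "\<And>x y. x \<in> A \<Longrightarrow> y \<in> A \<Longrightarrow> (x, y) \<in> r \<Longrightarrow> x \<noteq> y \<Longrightarrow> \<rho> x \<noteq> \<rho> y"
    and C: "C \<in> Chains r" "C \<subseteq> A" "card C = n"
  shows "height A r = n"
  unfolding height_def
proof (rule Max_eqI)
  show "finite (card ` {C \<in> Chains r. C \<subseteq> A})" using fin by auto
  show "n \<in> card ` {C \<in> Chains r. C \<subseteq> A}" using C by auto
next
  fix m assume "m \<in> card ` {C \<in> Chains r. C \<subseteq> A}"
  then obtain D where D: "D \<in> Chains r" "D \<subseteq> A" "m = card D" by auto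
  have "inj_on \<rho> D"
  proof (rule inj_onI, rule ccontr)
    fix x y assume xy: "x \<in> D" "y \<in> D" "\<rho> x = \<rho> y" "x \<noteq> y"
    then have "(x, y) \<in> r \<or> (y, x) \<in> r" using D(1) by (auto simp: Chains_def)
    then show False using rank(2)[of x y] rank(2)[of y x] xy D(2) by auto
  qed
  moreover have "\<rho> ` D \<subseteq> {..<n}" using D rank(1) by auto
  ultimately have "card D \<le> card {..<n}" using card_inj_on_le by blast
  then show "m \<le> n" using D by simp
qed

section \<open>The poset\<close>

text \<open>The Boolean tells the two kinds of element apart; coding into \<open>nat\<close> matches
  the carrier type of the final statement.\<close>

definition dn :: "bool list \<Rightarrow> nat" where "dn s = to_nat (False, s)"

definition up :: "bool list \<Rightarrow> nat" where "up s = to_nat (True, s)"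

lemma dn_up_simps [simp]:
  "dn s = dn t \<longleftrightarrow> s = t" "up s = up t \<longleftrightarrow> s = t" "dn s \<noteq> up t" "up t \<noteq> dn s"
  by (auto simp: dn_def up_def)

definition words :: "nat \<Rightarrow> bool list set" where
  "words k = {s. s \<noteq> [] \<and> length s \<le> k}"

definition elems :: "nat \<Rightarrow> nat set" where
  "elems k = dn ` words k \<union> up ` words k"

definition order :: "nat \<Rightarrow> nat rel" where
  "order k = {(dn s, dn t) |s t. s \<in> words k \<and> t \<in> words k \<and> prefix t s}
     \<union> {(up s, up t) |s t. s \<in> words k \<and> t \<in> words k \<and> prefix s t}
     \<union> {(dn s, up t) |s t. s \<in> words k \<and> t \<in> words k \<and> s \<parallel> t}"

lemma order_simps [simp]:
  "(dn s, dn t) \<in> order k \<longleftrightarrow> s \<in> words k \<and> t \<in> words k \<and> prefix t s"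
  "(up s, up t) \<in> order k \<longleftrightarrow> s \<in> words k \<and> t \<in> words k \<and> prefix s t"
  "(dn s, up t) \<in> order k \<longleftrightarrow> s \<in> words k \<and> t \<in> words k \<and> s \<parallel> t"
  "(up s, dn t) \<notin> order k"
  by (auto simp: order_def)

lemma elems_simps [simp]: "dn s \<in> elems k \<longleftrightarrow> s \<in> words k" "up s \<in> elems k \<longleftrightarrow> s \<in> words k"
  by (auto simp: elems_def)

lemma elemsE:
  assumes "x \<in> elems k"
  obtains s where "s \<in> words k" "x = dn s" | s where "s \<in> words k" "x = up s"
  using assms by (auto simp: elems_def)

lemma order_subset: "order k \<subseteq> elems k \<times> elems k"
  by (auto simp: order_def)

text \<open>A position where two words differ survives extension. Transitivity needs this when a
  chain passes from \<open>dn\<close> to \<open>up\<close>.\<close>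

lemma parallel_prefix:
  assumes "s \<parallel> t" "prefix s s'" "prefix t t'"
  shows "s' \<parallel> t'"
  using assms by (metis parallel_append prefixE)

lemma finite_words: "finite (words k)"
proof -
  have "words k \<subseteq> {xs. set xs \<subseteq> UNIV \<and> length xs \<le> k}" by (auto simp: words_def)
  then show ?thesis using finite_lists_length_le[OF finite_UNIV] finite_subset by blast
qed

lemma finite_poset_order: "finite_poset (elems k) (order k)"
proof -
  have "trans (order k)"
  proof (rule transI)
    fix x y z assume 1: "(x, y) \<in> order k" "(y, z) \<in> order k"
    then have "x \<in> elems k" "y \<in> elems k" "z \<in> elems k" using order_subset by blast+
    then show "(x, z) \<in> order k" using 1
      by (elim elemsE) (auto intro: parallel_prefix dest: prefix_order.trans)
  qed
  moreover have "antisym (order k)"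
  proof (rule antisymI)
    fix x y assume 1: "(x, y) \<in> order k" "(y, x) \<in> order k"
    then have "x \<in> elems k" "y \<in> elems k" using order_subset by blast+
    then show "x = y" using 1 by (elim elemsE) auto
  qed
  moreover have "refl_on (elems k) (order k)" by (auto simp: refl_on_def elim!: elemsE)
  ultimately show ?thesis using order_subset finite_words
    by (auto simp: finite_poset_def order_on_defs elems_def)
qed

lemma poset_dim_order:
  assumes "k \<ge> 1"
  shows "2 ^ k \<le> poset_dim (elems k) (order k)"
proof -
  let ?I = "{s :: bool list. length s = k}"
  have I: "s \<in> words k" if "s \<in> ?I" for s using that assms by (auto simp: words_def)
  have "s \<parallel> t" if "s \<in> ?I" "t \<in> ?I" "s \<noteq> t" for s t
    using that not_equal_is_parallel by force
  then have "card ?I \<le> poset_dim (elems k) (order k)"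
    using I by (intro card_standard_example_le_poset_dim[OF finite_poset_order, of _ dn _ up]) auto
  moreover have "card ?I = 2 ^ k"
    using card_lists_length_eq[of "UNIV :: bool set" k] by simp
  ultimately show ?thesis by simp
qed

text \<open>Levels \<open>0\<close> to \<open>k - 1\<close> hold the \<open>dn\<close> elements and
  \<open>k\<close> to \<open>2 * k - 1\<close> the \<open>up\<close> elements; the
  \<open>- 1\<close> is there because words have length at least one.\<close>

definition rank :: "nat \<Rightarrow> nat \<Rightarrow> nat" where
  "rank k x = (case from_nat x of (b, s :: bool list) \<Rightarrow> if b then k + length s - 1 else k - length s)"

lemma rank_simps [simp]: "rank k (dn s) = k - length s" "rank k (up s) = k + length s - 1"
  by (simp_all add: rank_def dn_def up_def)

lemma height_order:
  assumes "k \<ge> 1"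
  shows "height (elems k) (order k) = 2 * k"
proof (rule height_eqI)
  show "finite (elems k)" using finite_words by (simp add: elems_def)
  show "rank k x < 2 * k" if "x \<in> elems k" for x
    using that assms by (elim elemsE) (auto simp: words_def)
  show "rank k x \<noteq> rank k y" if "x \<in> elems k" "y \<in> elems k" "(x, y) \<in> order k" "x \<noteq> y" for x y
    using that
  proof (elim elemsE; clarsimp)
    fix s t :: "bool list"
    assume st: "s \<in> words k" "k - length s = k - length t" "prefix t s" "s \<noteq> t"
    then have "length t < length s" by (auto intro: prefix_length_less simp: strict_prefix_def)
    then show False using st by (auto simp: words_def)
  next
    fix s t :: "bool list"
    assume st: "s \<in> words k" "k + length s - Suc 0 = k + length t - Suc 0" "prefix s t" "s \<noteq> t"
    then have "length s < length t" by (auto intro: prefix_length_less simp: strict_prefix_def)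
    then show False using st by (cases s) (auto simp: words_def)
  next
    fix s t :: "bool list"
    assume "s \<in> words k" "t \<in> words k" "k - length s = k + length t - Suc 0"
    then show False by (cases s; cases t) (auto simp: words_def)
  qed
next
  let ?N = "{1..k}"
  \<comment> \<open>The \<open>dn\<close> words start with \<open>False\<close> and the
    \<open>up\<close> words with \<open>True\<close>, so all cross pairs are parallel and two chains
    of size \<open>k\<close> join into one.\<close>
  let ?s = "\<lambda>n. replicate n False" and ?t = "\<lambda>n. replicate n True"
  let ?C = "(dn \<circ> ?s) ` ?N \<union> (up \<circ> ?t) ` ?N"
  have w: "?s n \<in> words k" "?t n \<in> words k" if "n \<in> ?N" for n
    using that by (auto simp: words_def)
  have par: "?s m \<parallel> ?t n" if "m \<in> ?N" "n \<in> ?N" for m n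
    using that by (cases m; cases n) (auto intro: Cons_parallelI1)
  have pre: "prefix (replicate m x) (replicate n x)" if "m \<le> n" for m n and x :: bool
    using that by (metis le_add_diff_inverse prefixI replicate_add)
  show "?C \<subseteq> elems k" using w by auto
  show "?C \<in> Chains (order k)"
    using w par pre unfolding Chains_def by (auto; meson nat_le_linear)
  have "inj_on (dn \<circ> ?s) ?N" "inj_on (up \<circ> ?t) ?N" by (auto intro!: inj_onI)
  then have "card ((dn \<circ> ?s) ` ?N) = k" "card ((up \<circ> ?t) ` ?N) = k"
    by (simp_all only: card_image card_atLeastAtMost diff_Suc_1)
  moreover have "(dn \<circ> ?s) ` ?N \<inter> (up \<circ> ?t) ` ?N = {}" by auto
  ultimately show "card ?C = 2 * k"
    using card_Un_disjoint[of "(dn \<circ> ?s) ` ?N" "(up \<circ> ?t) ` ?N"] by simp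
qed

section \<open>Excluding the minor\<close>

text \<open>Pairs run from the lower to the upper end. Without the length bound \<open>k\<close>,
  the relation is uniform over all words and contains every cover relation.\<close>

definition edge :: "nat \<Rightarrow> nat \<Rightarrow> bool" where
  "edge p q \<longleftrightarrow> (\<exists>s x. (p, q) \<in> {(dn (s @ [x]), dn s), (up s, up (s @ [x])),
     (dn (s @ [x]), up (s @ [\<not> x]))})"

text \<open>An element between the ends of a cover is one of the ends. Inserting the word one letter
  past the common prefix therefore fixes the words of both ends.\<close>

lemma covers_edge:
  assumes "covers (elems k) (order k) p q"
  shows "edge p q"
proof -
  have pq: "p \<in> elems k" "q \<in> elems k" "(p, q) \<in> order k" "p \<noteq> q"
    and no: "\<And>c. (p, c) \<in> order k \<Longrightarrow> (c, q) \<in> order k \<Longrightarrow> c = p \<or> c = q"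
    using assms order_subset unfolding covers_def by blast+
  have word: "s @ [x] \<in> words k" if "s @ x # xs \<in> words k" for s x xs
    using that by (auto simp: words_def)
  consider s t where "p = dn s" "q = dn t" | s t where "p = up s" "q = up t"
    | s t where "p = dn s" "q = up t"
    using pq(1-3) by (elim elemsE) auto
  then show ?thesis
  proof cases
    case 1
    then have st: "s \<in> words k" "t \<in> words k" "prefix t s" "s \<noteq> t" using pq by auto
    then obtain x xs where s: "s = t @ x # xs" by (metis append_Nil2 neq_Nil_conv prefixE)
    have "dn (t @ [x]) = p \<or> dn (t @ [x]) = q"
      using st s word by (intro no) (auto simp: 1)
    then show ?thesis by (auto simp: 1 s edge_def)
  next
    case 2
    then have st: "s \<in> words k" "t \<in> words k" "prefix s t" "s \<noteq> t" using pq by auto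
    then obtain x xs where t: "t = s @ x # xs" by (metis append_Nil2 neq_Nil_conv prefixE)
    have "up (s @ [x]) = p \<or> up (s @ [x]) = q"
      using st t word by (intro no) (auto simp: 2)
    then show ?thesis by (auto simp: 2 t edge_def)
  next
    case 3
    then have st: "s \<in> words k" "t \<in> words k" "s \<parallel> t" using pq by auto
    then obtain u x xs y ys where u: "x \<noteq> y" "s = u @ x # xs" "t = u @ y # ys"
      using parallel_decomp[OF st(3)] by blast
    have par: "u @ x # a \<parallel> u @ y # b" for a b
      using u(1) by (auto simp: parallel_def)
    have "dn (u @ [x]) = p \<or> dn (u @ [x]) = q"
      using st u(2,3) word par by (intro no) (auto simp: 3)
    moreover have "up (u @ [y]) = p \<or> up (u @ [y]) = q"
      using st u(2,3) word par by (intro no) (auto simp: 3)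
    \<comment> \<open>No \<open>dn\<close> equals an \<open>up\<close>, so each inserted element is
      the end of its own kind; with two letters, \<open>y\<close> is the negation of
      \<open>x\<close>.\<close>
    ultimately have "p = dn (u @ [x])" "q = up (u @ [\<not> x])" using u(1) by (auto simp: 3)
    then show ?thesis unfolding edge_def by blast
  qed
qed

section \<open>Separating pairs in the cover graph\<close>

definition below :: "bool list \<Rightarrow> nat set" where
  "below u = {dn s |s. strict_prefix u s} \<union> {up s |s. strict_prefix u s}"

lemma below_simps [simp]: "dn s \<in> below u \<longleftrightarrow> strict_prefix u s" "up s \<in> below u \<longleftrightarrow> strict_prefix u s"
  by (auto simp: below_def)

definition red :: "bool list \<Rightarrow> nat set" where
  "red u = {dn u, up (u @ [False]), up (u @ [True])}"

text \<open>The pair \<open>dn u\<close>, \<open>up u\<close> separates \<open>below u\<close> from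
  the rest: sibling words extend \<open>u\<close> properly together, and a child does so without its
  parent only if the parent is \<open>u\<close>.\<close>

lemma edge_leaves_below:
  assumes "edge p q \<or> edge q p" "p \<in> below u" "q \<notin> below u"
  shows "q \<in> {dn u, up u}"
  using assms by (auto simp: edge_def strict_prefix_def)

lemma strict_prefix_child:
  assumes "strict_prefix u s"
  obtains x where "prefix (u @ [x]) s"
  using assms by (metis append_Cons append_Nil append_assoc prefixI strict_prefixE')

text \<open>
  The three cases: the edge lies in the part hanging off a child of \<open>u\<close>, outside the part hanging off
  \<open>u\<close>, or in the copy of \<open>K\<^bsub>3,3\<^esub>\<close> at \<open>u\<close>; there it has an end in the colour class \<open>red u\<close>.
\<close>
lemma edge_location:
  assumes "edge p q"
  obtains x where "p \<in> below (u @ [x]) \<union> {dn (u @ [x]), up (u @ [x])}"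
      "q \<in> below (u @ [x]) \<union> {dn (u @ [x]), up (u @ [x])}"
    | "p \<notin> below u" "q \<notin> below u"
    | "p \<in> red u \<or> q \<in> red u"
proof -
  obtain s x where pq: "(p, q) \<in> {(dn (s @ [x]), dn s), (up s, up (s @ [x])),
     (dn (s @ [x]), up (s @ [\<not> x]))}"
    using assms unfolding edge_def by blast
  \<comment> \<open>The parent word \<open>s\<close> of the edge decides its location relative to
    \<open>u\<close>.\<close>
  consider "strict_prefix u s" | "s = u" | "\<not> prefix u s" by (auto simp: strict_prefix_def)
  then show thesis
  proof cases
    case 1
    then obtain y where "prefix (u @ [y]) s" by (rule strict_prefix_child)
    then show thesis using pq by (intro that(1)[of y]) (auto simp: strict_prefix_def)
  next
    case 2
    then have "p \<in> red u \<or> q \<in> red u" using pq by (cases x) (auto simp: red_def)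
    then show thesis by (rule that(3))
  next
    case 3
    then show thesis using pq by (intro that(2)) (auto simp: strict_prefix_def)
  qed
qed

lemma connected_induce_subgraph_boundary:
  assumes con: "Digraph_Component.connected (induce_subgraph (with_proj G) B)"
    and x: "x \<in> B" "x \<in> D" and nD: "\<not> B \<subseteq> D"
  obtains p q where "p \<in> B" "p \<in> D" "q \<in> B" "q \<notin> D" "(p, q) \<in> parcs G \<or> (q, p) \<in> parcs G"
proof -
  let ?H = "mk_symmetric (induce_subgraph (with_proj G) B)"
  obtain y where y: "y \<in> B" "y \<notin> D" using nD by blast
  have "(x, y) \<in> rtrancl_on (pverts ?H) (parcs ?H)"
    using con x y unfolding Digraph_Component.connected_def
    by (auto simp: strongly_connected_def reachable_def)
  \<comment> \<open>Invariant along a walk inside \<open>B\<close>: it is still in \<open>D\<close>,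
    or an arc leaving \<open>D\<close> has been found.\<close>
  then have "y \<in> D \<or> thesis"
  proof (induction rule: rtrancl_on_induct)
    case base
    then show ?case using x by simp
  next
    case (step a b)
    then have "a \<in> B" "b \<in> B" "(a, b) \<in> parcs G \<or> (b, a) \<in> parcs G"
      by (auto simp: mk_symmetric_def arcs_ends_conv)
    then show ?case using step.IH that by blast
  qed
  then show thesis using y by blast
qed

lemma no_complete_5_minor:
  assumes K: "complete_digraph 5 (with_proj K)"
    and minor: "minor_of K (cover_graph (elems k) (order k))"
  shows False
proof -
  let ?G = "cover_graph (elems k) (order k)" and ?V = "pverts K"
  have V: "finite ?V" "card ?V = 5" "parcs K = {(u, v). (u, v) \<in> ?V \<times> ?V \<and> u \<noteq> v}"
    using K by (auto simp: complete_digraph_pair_def)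
  obtain B where B: "\<forall>i\<in>?V. B i \<subseteq> pverts ?G \<and>
      Digraph_Component.connected (induce_subgraph (with_proj ?G) (B i))"
    "\<forall>i\<in>?V. \<forall>j\<in>?V. i \<noteq> j \<longrightarrow> B i \<inter> B j = {}"
    "\<forall>(i, j)\<in>parcs K. \<exists>x\<in>B i. \<exists>y\<in>B j. (x, y) \<in> parcs ?G"
    using minor unfolding minor_of_def by blast
  have sub: "B i \<subseteq> elems k" if "i \<in> ?V" for i
    using B(1) that by (simp add: cover_graph_def)
  have con: "Digraph_Component.connected (induce_subgraph (with_proj ?G) (B i))" if "i \<in> ?V" for i
    using B(1) that by blast
  have disj: "B i \<inter> B j = {}" if "i \<in> ?V" "j \<in> ?V" "i \<noteq> j" for i j
    using B(2) that by blast
  have adj: "\<exists>x\<in>B i. \<exists>y\<in>B j. (x, y) \<in> parcs ?G" if "i \<in> ?V" "j \<in> ?V" "i \<noteq> j" for i j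
    using B(3) that unfolding V(3) by blast
  have arc: "edge p q \<or> edge q p" if "(p, q) \<in> parcs ?G" for p q
    using that covers_edge by (auto simp: cover_graph_def)
  have ne: "B i \<noteq> {}" if "i \<in> ?V" for i
    using con[OF that] by (auto simp: Digraph_Component.connected_def strongly_connected_def)
  \<comment> \<open>A connected branch set leaving \<open>below v\<close> must use the separating
    pair of \<open>v\<close>.\<close>
  have sep: "dn v \<in> B i \<or> up v \<in> B i" if "i \<in> ?V" "p \<in> B i" "p \<in> below v" "\<not> B i \<subseteq> below v" for i p v
    using connected_induce_subgraph_boundary[OF con[OF that(1)] that(2-4)] arc edge_leaves_below
    by (metis empty_iff insert_iff)
  let ?P = "\<lambda>u. \<exists>i\<in>?V. B i \<subseteq> below u"
  obtain i0 where i0: "i0 \<in> ?V" using V(2) by fastforce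
  \<comment> \<open>Words of elements are nonempty, so the empty word is a first candidate for
    \<open>u\<close>.\<close>
  have "B i0 \<subseteq> below []"
    using sub[OF i0] by (auto simp: words_def strict_prefix_def elim!: elemsE dest!: subsetD)
  then have P0: "?P []" using i0 by blast
  have bound: "length u < Suc k" if "?P u" for u
  proof -
    obtain i where i: "i \<in> ?V" "B i \<subseteq> below u" using \<open>?P u\<close> by blast
    then obtain p where "p \<in> elems k" "p \<in> below u" using ne[OF i(1)] sub[OF i(1)] by blast
    then show ?thesis by (elim elemsE) (auto simp: words_def dest: prefix_length_less)
  qed
  obtain u where Pu: "?P u" and longest: "\<And>v. ?P v \<Longrightarrow> length v \<le> length u"
    using ex_has_greatest_nat[of ?P "[]" length "Suc k"] P0 bound by blast
  have child: "\<not> B i \<subseteq> below (u @ [x])" if "i \<in> ?V" for i x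
    using longest[of "u @ [x]"] that by auto
  obtain j where j: "j \<in> ?V" "B j \<subseteq> below u" using Pu by blast
  \<comment> \<open>Every other branch set has an edge to \<open>B j\<close>, which lies in
    \<open>below u\<close>; it either stays in \<open>below u\<close> or meets the separating
    pair.\<close>
  have meets: "B i \<subseteq> below u \<or> dn u \<in> B i \<or> up u \<in> B i" if i: "i \<in> ?V" for i
  proof (cases "i = j")
    case False
    then obtain p q where "p \<in> B j" "q \<in> B i" "edge p q \<or> edge q p"
      using adj j i arc by metis
    then show ?thesis using edge_leaves_below[of p q u] sep[OF i, of q u] j by blast
  qed (use j in simp)
  \<comment> \<open>If the edge lies at a child of \<open>u\<close>, both branch sets meet the
    child's pair, and by disjointness one of them owns its \<open>up\<close>, which is red. If it
    lies outside \<open>below u\<close>, both meet the pair of \<open>u\<close>, and one owns the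
    red \<open>dn u\<close>.\<close>
  have red: "(B i \<union> B j) \<inter> red u \<noteq> {}" if ij: "i \<in> ?V" "j \<in> ?V" "i \<noteq> j" for i j
  proof -
    obtain p q where pq: "p \<in> B i" "q \<in> B j" and e: "edge p q \<or> edge q p"
      using adj arc ij by metis
    have dj: "B i \<inter> B j = {}" using disj ij by blast
    consider x where "p \<in> below (u @ [x]) \<union> {dn (u @ [x]), up (u @ [x])}"
      "q \<in> below (u @ [x]) \<union> {dn (u @ [x]), up (u @ [x])}"
    | "p \<notin> below u" "q \<notin> below u" | "p \<in> red u \<or> q \<in> red u"
      using e edge_location[of p q u] edge_location[of q p u] by metis
    then show ?thesis
    proof cases
      case (1 x)
      then have "dn (u @ [x]) \<in> B i \<or> up (u @ [x]) \<in> B i" "dn (u @ [x]) \<in> B j \<or> up (u @ [x]) \<in> B j"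
        using pq sep[OF ij(1), of p] sep[OF ij(2), of q] child ij by blast+
      then have "up (u @ [x]) \<in> B i \<union> B j" using dj by blast
      then show ?thesis by (cases x) (auto simp: red_def)
    next
      case 2
      then have "dn u \<in> B i \<or> up u \<in> B i" "dn u \<in> B j \<or> up u \<in> B j"
        using meets ij pq by blast+
      then show ?thesis using dj by (auto simp: red_def)
    next
      case 3
      then show ?thesis using pq by blast
    qed
  qed
  let ?R = "{i \<in> ?V. B i \<inter> red u \<noteq> {}}"
  \<comment> \<open>Two branch sets avoiding \<open>red u\<close> would contradict
    \<open>red\<close>.\<close>
  have "card (?V - ?R) \<le> Suc 0"
    using red V(1) by (subst card_le_Suc0_iff_eq) blast+
  then have "card ?R \<ge> 4"
    using V card_Diff_subset[of ?R ?V] by simp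
  moreover have "card ?R \<le> card (red u)"
  proof -
    \<comment> \<open>Disjointness makes the choice of one red vertex per branch set injective, so
      four branch sets would need four red vertices.\<close>
    define f where "f i = (SOME x. x \<in> B i \<inter> red u)" for i
    have f: "f i \<in> B i \<inter> red u" if "i \<in> ?R" for i
      unfolding f_def using that by (intro someI_ex[of "\<lambda>x. x \<in> B i \<inter> red u"]) blast
    have "inj_on f ?R"
    proof (rule inj_onI, rule ccontr)
      fix i j assume ij: "i \<in> ?R" "j \<in> ?R" "f i = f j" "i \<noteq> j"
      then have "f i \<in> B i \<inter> B j" using f[OF ij(1)] f[OF ij(2)] by simp
      then show False using disj[of i j] ij by blast
    qed
    moreover have "f ` ?R \<subseteq> red u" using f by blast
    moreover have "finite (red u)" by (simp add: red_def)
    ultimately show ?thesis using card_inj_on_le by blast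
  qed
  moreover have "card (red u) = 3" by (simp add: red_def)
  ultimately show False by simp
qed

theorem theorem4:
  fixes h :: nat
  assumes "even h" and "h \<ge> 2"
  shows "\<exists>(A :: nat set) (r :: nat rel).
           finite_poset A r \<and>
           height A r = h \<and>
           poset_dim A r \<ge> 2 ^ (h div 2) \<and>
           \<not> (\<exists>K :: nat pair_pre_digraph.
                 complete_digraph 5 (with_proj K) \<and> minor_of K (cover_graph A r))"
proof -
  define k where "k = h div 2"
  have k: "k \<ge> 1" "h = 2 * k" using assms by (auto simp: k_def)
  show ?thesis
  proof (intro exI conjI)
    show "finite_poset (elems k) (order k)" by (rule finite_poset_order)
    show "height (elems k) (order k) = h" using height_order[OF k(1)] k(2) by simp
    show "2 ^ (h div 2) \<le> poset_dim (elems k) (order k)"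
      using poset_dim_order[OF k(1)] unfolding k_def .
    show "\<not> (\<exists>K :: nat pair_pre_digraph.
        complete_digraph 5 (with_proj K) \<and> minor_of K (cover_graph (elems k) (order k)))"
      using no_complete_5_minor by blast
  qed
qed

end
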